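(* Consider the quadratic program $(QP)$ described in the context and suppose it is a $0$-$1$ program, i.e. $p\ge n$ and for each $i\in\{1,\dots,n\}$ the $i$-th (non-redundant) quadratic constraint is the equality $x_i^2=x_i$. With the extended-real values $D$, $TL^{x}$, $TL^{X}$, $PL^{X}$, $PL^{x}$ and $S$ defined in the context ($S$ being the optimum value of the SDP relaxation of $(QP)$ and $D$ the optimum value of its dual), $$D=TL^{x}=TL^{X}=PL^{X}=S\ \le\ PL^{x}.$$
   Context: Notation: $M\cdot N=\sum_{i,j}M_{ij}N_{ij}$; $M\succeq0$ means symmetric positive semidefinite; infima/suprema are taken in $[-\infty,+\infty]$, with $\inf\emptyset=+\infty$, $\sup\emptyset=-\infty$. Data: $n\ge1$; symmetric $Q,B_1,\dots,B_p,\overline B_1,\dots,\overline B_{\bar p}\in\mathbb{R}^{n\times n}$; $c,d_1,\dots,d_p,\bar d_1,\dots,\bar d_{\bar p}\in\mathbb{R}^n$; $e\in\mathbb{R}^p$, $\bar e\in\mathbb{R}^{\bar p}$; $A\in\mathbb{R}^{q\times n}$, $b\in\mathbb{R}^q$. The program is $$(QP)\ \min_{x\in\mathbb{R}^n}\ Q\cdot xx^\top+c^\top x\ \text{ s.t. } Ax=b;\ \overline B_j\cdot xx^\top+\bar d_j^\top x=\bar e_j\ (1\le j\le\bar p);\ B_i\cdot xx^\top+d_i^\top x=e_i\ \text{or}\le e_i\ (1\le i\le p),$$ where each constraint $i$ is a fixed choice of equality or inequality. The constraints indexed by $j$ are redundant: they hold for every $x$ with $Ax=b$. SDP relaxation: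 $S=\inf\{Q\cdot X+c^\top x:\ Ax=b;\ \overline B_j\cdot X+\bar d_j^\top x=\bar e_j\ \forall j;\ B_i\cdot X+d_i^\top x=e_i\ (\text{resp. }\le e_i)\ \forall i;\ \begin{bmatrix}1 & x^\top \\ x & X\end{bmatrix}\succeq0\}$. Multipliers: $\mathcal M=\{\mu\in\mathbb{R}^p:\mu_i\ge0\text{ whenever constraint } i \text{ is an inequality}\}$. For $\mu\in\mathcal M$, $\nu\in\mathbb{R}^{\bar p}$ put $Q_{\mu,\nu}=Q+\sum_i\mu_iB_i+\sum_j\nu_j\overline B_j$, $c_{\mu,\nu}=c+\sum_i\mu_id_i+\sum_j\nu_j\bar d_j$, $\kappa_{\mu,\nu}=\mu^\top e+\nu^\top\bar e$. Partial Lagrangian in $x$: $PL^{x}=\sup_{\mu\in\mathcal M}\inf\{Q_{\mu,0}\cdot xx^\top+c_{\mu,0}^\top x-\mu^\top e:\ x\in\mathbb{R}^n,\ Ax=b\}$. Partial Lagrangian in $X$: $PL^{X}=\sup_{\mu\in\mathcal M,\nu}\inf\{Q_{\mu,\nu}\cdot X+c_{\mu,\nu}^\top x-\kappa_{\mu,\nu}:\ Ax=b,\ \begin{bmatrix}1 & x^\top \\ x & X\end{bmatrix}\succeq0\}$. Total Lagrangians: $TL^{x}=\sup_{\mu\in\mathcal M,\nu,\beta\in\mathbb{R}^q}\inf_{x\in\mathbb{R}^n}\{Q_{\mu,\nu}\cdot xx^\top+(c_{\mu,\nu}+A^\top\beta)^\top x-\kappa_{\mu,\nu}-\beta^\top b\}$,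 and $TL^{X}$ is the same with $xx^\top$ replaced by $X$ and the infimum over all $(x,X)$ with $\begin{bmatrix}1 & x^\top \\ x & X\end{bmatrix}\succeq0$. Dual of the SDP relaxation: $$D=\sup\Big\{t-\kappa_{\mu,\nu}-\beta^\top b:\ t\in\mathbb{R},\mu\in\mathcal M,\nu\in\mathbb{R}^{\bar p},\beta\in\mathbb{R}^q,\ \begin{bmatrix}-t & \tfrac12(c_{\mu,\nu}+A^\top\beta)^\top \\ \tfrac12(c_{\mu,\nu}+A^\top\beta) & Q_{\mu,\nu}\end{bmatrix}\succeq0\Big\}.$$ *)

theory Defs
  imports "HOL-Analysis.Analysis"
begin

text \<open>
  On \<open>real ^ 'n ^ 'n\<close> the library inner product \<open>M \<bullet> N\<close> is the sum over all \<open>i, j\<close> of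
  \<open>M $ i $ j * N $ i $ j\<close>, i.e. the trace product of matrices.
\<close>

definition psd :: "real ^ 'k ^ 'k \<Rightarrow> bool" where
  "psd M \<longleftrightarrow> transpose M = M \<and> (\<forall>v. 0 \<le> v \<bullet> (M *v v))"

definition outer :: "real ^ 'n \<Rightarrow> real ^ 'n ^ 'n" where
  "outer x = (\<chi> i j. x $ i * x $ j)"

text \<open>
  \<open>bordered a y M\<close> is the block matrix with rows \<open>[a, y\<^sup>T]\<close> and \<open>[y, M]\<close>. Its order is
  \<open>CARD('n) + 1\<close>; the index \<open>None\<close> is the additional (first) row and column.
\<close>

definition bordered :: "real \<Rightarrow> real ^ 'n \<Rightarrow> real ^ 'n ^ 'n \<Rightarrow> real ^ ('n option) ^ ('n option)" where
  "bordered a y M = (\<chi> r s.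
     case r of
       None \<Rightarrow> (case s of None \<Rightarrow> a | Some j \<Rightarrow> y $ j)
     | Some i \<Rightarrow> (case s of None \<Rightarrow> y $ i | Some j \<Rightarrow> M $ i $ j))"

text \<open>
  The unknown ranges over \<open>real ^ 'n\<close>. The families of constraints are indexed by natural numbers
  \<open>1, \<dots>, count\<close>, so that any of them may be empty; what a family does outside its index range is
  irrelevant. The field \<open>ineqs\<close> holds the indices of those constraints
  \<open>B\<^sub>i \<bullet> xx\<^sup>T + d\<^sub>i \<bullet> x\<close> versus \<open>e\<^sub>i\<close> that are inequalities (\<open>\<le>\<close>), all others being equalities.
  The constraints with coefficients \<open>red_B, red_d, red_e\<close> are the redundant ones. The matrix \<open>A\<close> of the
  linear constraints is given by its rows.
\<close>

record ('n::finite) qp =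
  obj_Q :: "real ^ 'n ^ 'n"
  obj_c :: "real ^ 'n"
  con_num :: nat
  ineqs :: "nat set"
  con_B :: "nat \<Rightarrow> real ^ 'n ^ 'n"
  con_d :: "nat \<Rightarrow> real ^ 'n"
  con_e :: "nat \<Rightarrow> real"
  red_num :: nat
  red_B :: "nat \<Rightarrow> real ^ 'n ^ 'n"
  red_d :: "nat \<Rightarrow> real ^ 'n"
  red_e :: "nat \<Rightarrow> real"
  lin_num :: nat
  lin_A :: "nat \<Rightarrow> real ^ 'n"
  lin_b :: "nat \<Rightarrow> real"

definition lin_feasible :: "'n::finite qp \<Rightarrow> (real ^ 'n) set" where
  "lin_feasible P = {x. \<forall>k\<in>{1..lin_num P}. lin_A P k \<bullet> x = lin_b P k}"

definition quadratic_program :: "'n::finite qp \<Rightarrow> bool" where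
  "quadratic_program P \<longleftrightarrow>
     transpose (obj_Q P) = obj_Q P \<and>
     (\<forall>i\<in>{1..con_num P}. transpose (con_B P i) = con_B P i) \<and>
     (\<forall>j\<in>{1..red_num P}. transpose (red_B P j) = red_B P j) \<and>
     (\<forall>x\<in>lin_feasible P. \<forall>j\<in>{1..red_num P}. red_B P j \<bullet> outer x + red_d P j \<bullet> x = red_e P j)"

text \<open>
  \<open>\<sigma>\<close> numbers the coordinates \<open>x\<^sub>1, \<dots>, x\<^sub>n\<close> of \<open>real ^ 'n\<close>, where \<open>n = CARD('n)\<close>. The coefficients
  below are those of the equality \<open>x\<^sub>i\<^sup>2 - x\<^sub>i = 0\<close>.
\<close>

definition zero_one_program :: "(nat \<Rightarrow> 'n::finite) \<Rightarrow> 'n qp \<Rightarrow> bool" where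
  "zero_one_program \<sigma> P \<longleftrightarrow>
     CARD('n) \<le> con_num P \<and>
     (\<forall>i\<in>{1..CARD('n)}.
        i \<notin> ineqs P \<and>
        con_B P i = (\<chi> k l. if k = \<sigma> i \<and> l = \<sigma> i then 1 else 0) \<and>
        con_d P i = - axis (\<sigma> i) 1 \<and>
        con_e P i = 0)"

definition lifted :: "((real ^ 'n) \<times> (real ^ 'n ^ 'n)) set" where
  "lifted = {(x, X). psd (bordered 1 x X)}"

definition sdp_feasible :: "'n::finite qp \<Rightarrow> ((real ^ 'n) \<times> (real ^ 'n ^ 'n)) set" where
  "sdp_feasible P = {(x, X).
     x \<in> lin_feasible P \<and>
     (\<forall>j\<in>{1..red_num P}. red_B P j \<bullet> X + red_d P j \<bullet> x = red_e P j) \<and>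
     (\<forall>i\<in>{1..con_num P}. if i \<in> ineqs P then con_B P i \<bullet> X + con_d P i \<bullet> x \<le> con_e P i
                                         else con_B P i \<bullet> X + con_d P i \<bullet> x = con_e P i) \<and>
     (x, X) \<in> lifted}"

definition sdp_value :: "'n::finite qp \<Rightarrow> ereal" where
  "sdp_value P = (INF (x, X)\<in>sdp_feasible P. ereal (obj_Q P \<bullet> X + obj_c P \<bullet> x))"

definition multipliers :: "'n::finite qp \<Rightarrow> (nat \<Rightarrow> real) set" where
  "multipliers P = {\<mu>. \<forall>i\<in>{1..con_num P}. i \<in> ineqs P \<longrightarrow> 0 \<le> \<mu> i}"

definition Q_mult :: "'n::finite qp \<Rightarrow> (nat \<Rightarrow> real) \<Rightarrow> (nat \<Rightarrow> real) \<Rightarrow> real ^ 'n ^ 'n" where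
  "Q_mult P \<mu> \<nu> =
     obj_Q P + (\<Sum>i=1..con_num P. \<mu> i *\<^sub>R con_B P i) + (\<Sum>j=1..red_num P. \<nu> j *\<^sub>R red_B P j)"

definition c_mult :: "'n::finite qp \<Rightarrow> (nat \<Rightarrow> real) \<Rightarrow> (nat \<Rightarrow> real) \<Rightarrow> real ^ 'n" where
  "c_mult P \<mu> \<nu> =
     obj_c P + (\<Sum>i=1..con_num P. \<mu> i *\<^sub>R con_d P i) + (\<Sum>j=1..red_num P. \<nu> j *\<^sub>R red_d P j)"

definition kappa :: "'n::finite qp \<Rightarrow> (nat \<Rightarrow> real) \<Rightarrow> (nat \<Rightarrow> real) \<Rightarrow> real" where
  "kappa P \<mu> \<nu> = (\<Sum>i=1..con_num P. \<mu> i * con_e P i) + (\<Sum>j=1..red_num P. \<nu> j * red_e P j)"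

definition At_mult :: "'n::finite qp \<Rightarrow> (nat \<Rightarrow> real) \<Rightarrow> real ^ 'n" where
  "At_mult P \<beta> = (\<Sum>k=1..lin_num P. \<beta> k *\<^sub>R lin_A P k)"

definition b_mult :: "'n::finite qp \<Rightarrow> (nat \<Rightarrow> real) \<Rightarrow> real" where
  "b_mult P \<beta> = (\<Sum>k=1..lin_num P. \<beta> k * lin_b P k)"

definition partial_lagrangian_x :: "'n::finite qp \<Rightarrow> ereal" where
  "partial_lagrangian_x P =
     (SUP \<mu>\<in>multipliers P. INF x\<in>lin_feasible P.
        ereal (Q_mult P \<mu> (\<lambda>_. 0) \<bullet> outer x + c_mult P \<mu> (\<lambda>_. 0) \<bullet> x
               - (\<Sum>i=1..con_num P. \<mu> i * con_e P i)))"

definition partial_lagrangian_X :: "'n::finite qp \<Rightarrow> ereal" where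
  "partial_lagrangian_X P =
     (SUP (\<mu>, \<nu>)\<in>multipliers P \<times> UNIV. INF (x, X)\<in>{(x, X)\<in>lifted. x \<in> lin_feasible P}.
        ereal (Q_mult P \<mu> \<nu> \<bullet> X + c_mult P \<mu> \<nu> \<bullet> x - kappa P \<mu> \<nu>))"

definition total_lagrangian_x :: "'n::finite qp \<Rightarrow> ereal" where
  "total_lagrangian_x P =
     (SUP (\<mu>, \<nu>, \<beta>)\<in>multipliers P \<times> UNIV \<times> UNIV. INF x.
        ereal (Q_mult P \<mu> \<nu> \<bullet> outer x + (c_mult P \<mu> \<nu> + At_mult P \<beta>) \<bullet> x
               - kappa P \<mu> \<nu> - b_mult P \<beta>))"

definition total_lagrangian_X :: "'n::finite qp \<Rightarrow> ereal" where
  "total_lagrangian_X P =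
     (SUP (\<mu>, \<nu>, \<beta>)\<in>multipliers P \<times> UNIV \<times> UNIV. INF (x, X)\<in>lifted.
        ereal (Q_mult P \<mu> \<nu> \<bullet> X + (c_mult P \<mu> \<nu> + At_mult P \<beta>) \<bullet> x
               - kappa P \<mu> \<nu> - b_mult P \<beta>))"

definition dual_feasible ::
  "'n::finite qp \<Rightarrow> (real \<times> (nat \<Rightarrow> real) \<times> (nat \<Rightarrow> real) \<times> (nat \<Rightarrow> real)) set" where
  "dual_feasible P = {(t, \<mu>, \<nu>, \<beta>).
     \<mu> \<in> multipliers P \<and>
     psd (bordered (- t) ((1 / 2) *\<^sub>R (c_mult P \<mu> \<nu> + At_mult P \<beta>)) (Q_mult P \<mu> \<nu>))}"

definition sdp_dual_value :: "'n::finite qp \<Rightarrow> ereal" where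
  "sdp_dual_value P =
     (SUP (t, \<mu>, \<nu>, \<beta>)\<in>dual_feasible P. ereal (t - kappa P \<mu> \<nu> - b_mult P \<beta>))"

end

theory Submission
  imports Defs
begin

text \<open>
  The chains \<open>D \<le> TL\<^sup>X \<le> TL\<^sup>x \<le> D\<close>, \<open>TL\<^sup>X \<le> PL\<^sup>X \<le> S\<close> and \<open>TL\<^sup>x \<le> PL\<^sup>x\<close> hold for every quadratic
  program; the 0-1 constraints are only needed for \<open>S \<le> D\<close>. There, homogenise the relaxation: the
  bordered matrices, rescaled to trace 1, form a compact convex set, and if \<open>s < S\<close> then the objective
  minus \<open>s\<close> is positive wherever the homogenised constraints hold (a matrix with vanishing corner
  would be excluded by \<open>X\<^sub>i\<^sub>i = x\<^sub>i\<close>). By compactness, multipliers exist making the Lagrangian minus \<open>s\<close>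
  positive on the whole set, which is dual feasibility with value \<open>s\<close>. No constraint qualification
  is needed, and an infeasible relaxation is covered.
\<close>

section \<open>Positive semidefinite matrices\<close>

lemma inner_matrix: "M \<bullet> N = (\<Sum>i\<in>UNIV. \<Sum>j\<in>UNIV. M $ i $ j * N $ i $ j)"
  for M N :: "real ^ 'k ^ 'm"
  by (simp add: inner_vec_def)

lemma inner_outer: "M \<bullet> outer v = v \<bullet> (M *v v)"
  by (simp add: inner_vec_def outer_def matrix_vector_mult_def sum_distrib_left mult_ac)

text \<open>Trace products make every condition linear in \<open>M\<close>, so closedness, convexity
  and duality arguments apply directly.\<close>

lemma psd_iff: "psd M \<longleftrightarrow> transpose M = M \<and> (\<forall>v. 0 \<le> M \<bullet> outer v)"
  by (simp add: psd_def inner_outer)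

lemma transpose_outer: "transpose (outer x) = outer x"
  by (simp add: transpose_def outer_def vec_eq_iff mult.commute)

lemma outer_inner_outer: "outer v \<bullet> outer w = (v \<bullet> w)\<^sup>2"
  by (simp add: inner_matrix outer_def inner_vec_def power2_eq_square sum_product mult_ac)

lemma psd_outer: "psd (outer x)"
  by (simp add: psd_iff transpose_outer outer_inner_outer)

lemma transpose_eq_nth: "transpose M = M \<Longrightarrow> M $ i $ j = M $ j $ i"
  by (metis transpose_def vec_lambda_beta)

lemma inner_outer_add_axis:
  fixes M :: "real ^ 'k ^ 'k"
  assumes "transpose M = M"
  shows "M \<bullet> outer (v + t *\<^sub>R axis i 1) = M \<bullet> outer v + 2 * t * (M $ i \<bullet> v) + t\<^sup>2 * M $ i $ i"
proof -
  have col: "v \<bullet> (M *v axis i 1) = M $ i \<bullet> v"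
    using transpose_eq_nth[OF assms]
    by (simp add: matrix_vector_mult_basis column_def inner_vec_def mult.commute)
  have row: "axis i 1 \<bullet> (M *v w) = M $ i \<bullet> w" for w
    unfolding inner_axis' by (simp add: matrix_vector_mult_def inner_vec_def)
  have "M $ i \<bullet> axis i 1 = M $ i $ i"
    by (simp add: inner_axis)
  then show ?thesis
    by (simp add: inner_outer matrix_vector_right_distrib matrix_vector_mult_scaleR
        inner_add_left inner_add_right col row power2_eq_square algebra_simps)
qed

lemma psd_diag_nonneg: "psd M \<Longrightarrow> 0 \<le> M $ i $ i"
  using inner_outer_add_axis[of M 0 1 i] inner_outer[of M 0] by (auto simp: psd_iff)
    (metis add_0)

text \<open>The quadratic form along a line of direction \<open>axis i 1\<close>; suitable choices
  of \<open>t\<close> replace arguments with 2x2 principal minors.\<close>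

lemma psd_add_axis_nonneg:
  assumes "psd M"
  shows "0 \<le> M $ j $ j + 2 * t * M $ i $ j + t\<^sup>2 * M $ i $ i"
proof -
  have sym: "transpose M = M" using assms by (simp add: psd_iff)
  have "M \<bullet> outer (axis j 1) = M $ j $ j"
    using inner_outer_add_axis[OF sym, of 0 1 j] inner_outer[of M 0] by simp
  moreover have "0 \<le> M \<bullet> outer (axis j 1 + t *\<^sub>R axis i 1)"
    using assms by (simp add: psd_iff)
  ultimately show ?thesis
    unfolding inner_outer_add_axis[OF sym] by (simp add: inner_axis)
qed

lemma psd_diag_zero:
  assumes "psd M" "M $ i $ i = 0"
  shows "M $ i $ j = 0"
proof (rule ccontr)
  assume nz: "M $ i $ j \<noteq> 0"
  \<comment> \<open>With a zero pivot the expression is affine in \<open>t\<close>; this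
    \<open>t\<close> gives it the value -1.\<close>
  have "0 \<le> M $ j $ j + 2 * (- (M $ j $ j + 1) / (2 * M $ i $ j)) * M $ i $ j"
    using psd_add_axis_nonneg[OF assms(1), of j _ i] assms(2) by (metis add.right_neutral mult_zero_right)
  then show False using nz by (simp add: field_simps)
qed

lemma psd_entry_bound:
  assumes "psd M"
  shows "2 * \<bar>M $ i $ j\<bar> \<le> M $ i $ i + M $ j $ j"
  using psd_add_axis_nonneg[OF assms, of j 1 i] psd_add_axis_nonneg[OF assms, of j "-1" i] by auto

text \<open>The Schur complement with pivot \<open>N $ i $ i\<close>: its form at \<open>v\<close>
  is the minimum of the form of \<open>N\<close> along
  \<open>v + t *\<^sub>R axis i 1\<close>.\<close>

lemma psd_eliminate:
  fixes N :: "real ^ 'k ^ 'k"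
  assumes "psd N" "N $ i $ i \<noteq> 0"
  shows "psd (N - (1 / N $ i $ i) *\<^sub>R outer (N $ i))"
proof -
  have sym: "transpose N = N" using assms by (simp add: psd_iff)
  have "transpose (N - (1 / N $ i $ i) *\<^sub>R outer (N $ i)) = N - (1 / N $ i $ i) *\<^sub>R outer (N $ i)"
    using transpose_eq_nth[OF sym] by (auto simp: vec_eq_iff transpose_def outer_def)
  moreover have "0 \<le> (N - (1 / N $ i $ i) *\<^sub>R outer (N $ i)) \<bullet> outer v" for v
  proof -
    have "0 \<le> N \<bullet> outer (v + (- (N $ i \<bullet> v) / N $ i $ i) *\<^sub>R axis i 1)"
      using assms by (simp add: psd_iff)
    then show ?thesis
      unfolding inner_outer_add_axis[OF sym] inner_diff_left inner_scaleR_left outer_inner_outer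
      using assms(2) by (simp add: field_simps power2_eq_square)
  qed
  ultimately show ?thesis by (simp add: psd_iff)
qed

text \<open>
  Symmetric Gaussian elimination writes \<open>N\<close> as a nonnegative combination of matrices \<open>outer v\<close>; each
  step clears one diagonal entry and keeps the zero ones.
\<close>

lemma psd_inner_nonneg:
  fixes M N :: "real ^ 'k ^ 'k"
  assumes "psd M" "psd N"
  shows "0 \<le> M \<bullet> N"
  using assms(2)
proof (induction "card {i. N $ i $ i \<noteq> 0}" arbitrary: N rule: less_induct)
  case less
  show ?case
  proof (cases "\<exists>i. N $ i $ i \<noteq> 0")
    case False
    then have "N = 0" using psd_diag_zero[OF less.prems] by (simp add: vec_eq_iff)
    then show ?thesis by simp
  next
    case True
    then obtain i where i: "N $ i $ i \<noteq> 0" by blast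
    define N' where "N' = N - (1 / N $ i $ i) *\<^sub>R outer (N $ i)"
    have psd: "psd N'" unfolding N'_def by (rule psd_eliminate[OF less.prems i])
    \<comment> \<open>A zero diagonal entry forces \<open>N $ i $ j = 0\<close>, so the subtracted
      matrix does not touch it.\<close>
    have "N' $ j $ j = 0" if "N $ j $ j = 0" for j
    proof -
      have "N $ i $ j = 0"
        using psd_diag_zero[OF less.prems that] less.prems transpose_eq_nth[of N i j] by (simp add: psd_iff)
      then show ?thesis using that by (simp add: N'_def outer_def)
    qed
    moreover have "N' $ i $ i = 0" using i by (simp add: N'_def outer_def)
    ultimately have "{j. N' $ j $ j \<noteq> 0} \<subset> {j. N $ j $ j \<noteq> 0}" using i by blast
    then have "card {j. N' $ j $ j \<noteq> 0} < card {j. N $ j $ j \<noteq> 0}"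
      by (simp add: psubset_card_mono)
    then have "0 \<le> M \<bullet> N'" using less.hyps psd by blast
    moreover have "M \<bullet> N = M \<bullet> N' + (1 / N $ i $ i) * (M \<bullet> outer (N $ i))"
      by (simp add: N'_def inner_diff_right)
    moreover have "0 \<le> M \<bullet> outer (N $ i)" using assms(1) by (simp add: psd_iff)
    ultimately show ?thesis using psd_diag_nonneg[OF less.prems, of i] by simp
  qed
qed

lemma closed_psd: "closed {M :: real ^ 'k ^ 'k. psd M}"
proof -
  have eq: "{M :: real ^ 'k ^ 'k. psd M} =
      (\<Inter>i. \<Inter>j. {M. M $ i $ j = M $ j $ i}) \<inter> (\<Inter>v. {M. 0 \<le> M \<bullet> outer v})"
    by (auto simp: psd_iff transpose_def vec_eq_iff)
  show ?thesis unfolding eq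
    by (intro closed_Int closed_INT ballI closed_Collect_eq closed_Collect_le continuous_intros)
qed

lemma psd_add: "psd M \<Longrightarrow> psd N \<Longrightarrow> psd (M + N)"
  by (auto simp: psd_iff inner_add_left transpose_def vec_eq_iff)

lemma psd_scaleR: "psd M \<Longrightarrow> 0 \<le> r \<Longrightarrow> psd (r *\<^sub>R M)"
  by (auto simp: psd_iff transpose_def vec_eq_iff)

section \<open>The trace-one slice: a compact base of the semidefinite cone\<close>

definition spectrahedron :: "(real ^ 'k ^ 'k) set" where
  "spectrahedron = {Y. psd Y \<and> (\<Sum>i\<in>UNIV. Y $ i $ i) = 1}"

lemma convex_spectrahedron: "convex spectrahedron"
  unfolding convex_def spectrahedron_def
  by (auto intro!: psd_add psd_scaleR simp: sum.distrib simp flip: sum_distrib_left)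

text \<open>The diagonal is nonnegative with sum 1, and it dominates the off-diagonal entries by
  \<open>psd_entry_bound\<close>; hence all entries are bounded.\<close>

lemma compact_spectrahedron: "compact (spectrahedron :: (real ^ 'k ^ 'k) set)"
proof -
  have "closed (spectrahedron :: (real ^ 'k ^ 'k) set)"
    unfolding spectrahedron_def
    by (intro closed_Collect_conj closed_psd closed_Collect_eq continuous_intros)
  moreover have "norm Y \<le> (\<Sum>i\<in>(UNIV::'k set). \<Sum>j\<in>(UNIV::'k set). 1)" if "Y \<in> spectrahedron" for Y :: "real ^ 'k ^ 'k"
  proof -
    have psd: "psd Y" and tr: "(\<Sum>i\<in>UNIV. Y $ i $ i) = 1"
      using that by (auto simp: spectrahedron_def)
    have d: "Y $ i $ i \<le> 1" for i
      using member_le_sum[of i UNIV "\<lambda>i. Y $ i $ i"] psd_diag_nonneg[OF psd] tr by simp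
    have e: "\<bar>Y $ i $ j\<bar> \<le> 1" for i j
      using psd_entry_bound[OF psd, of i j] d[of i] d[of j] by linarith
    have "norm Y \<le> (\<Sum>i\<in>UNIV. norm (Y $ i))"
      by (simp add: norm_vec_def L2_set_le_sum)
    also have "\<dots> \<le> (\<Sum>i\<in>UNIV. \<Sum>j\<in>UNIV. \<bar>Y $ i $ j\<bar>)"
      by (intro sum_mono norm_le_l1_cart)
    also have "\<dots> \<le> (\<Sum>i\<in>(UNIV::'k set). \<Sum>j\<in>(UNIV::'k set). 1)"
      by (intro sum_mono e)
    finally show ?thesis .
  qed
  ultimately show ?thesis by (auto simp: compact_eq_bounded_closed bounded_iff)
qed

section \<open>Bordered matrices\<close>

lemma sum_option: "(\<Sum>r\<in>UNIV. f r) = f None + (\<Sum>i\<in>UNIV. f (Some i))"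
  for f :: "'n::finite option \<Rightarrow> real"
  by (simp add: UNIV_option_conv sum.reindex)

lemma bordered_nth [simp]:
  "bordered a y M $ None $ None = a"
  "bordered a y M $ None $ Some j = y $ j"
  "bordered a y M $ Some i $ None = y $ i"
  "bordered a y M $ Some i $ Some j = M $ i $ j"
  by (simp_all add: bordered_def)

lemma vec_eq_iff_option: "x = y \<longleftrightarrow> x $ None = y $ None \<and> (\<forall>i. x $ Some i = y $ Some i)"
  for x y :: "'b ^ ('n::finite option)"
  by (metis not_Some_eq vec_eq_iff)

text \<open>The border is counted twice, as row and as column. This is why linear coefficients are
  halved in the dual and in the homogenised data.\<close>

lemma inner_bordered: "bordered a y M \<bullet> bordered b z N = a * b + 2 * (y \<bullet> z) + M \<bullet> N"
  unfolding inner_matrix sum_option by (simp add: inner_vec_def sum.distrib)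

lemma bordered_add: "bordered a y M + bordered b z N = bordered (a + b) (y + z) (M + N)"
  by (simp add: vec_eq_iff_option)

lemma bordered_scaleR: "r *\<^sub>R bordered a y M = bordered (r * a) (r *\<^sub>R y) (r *\<^sub>R M)"
  by (simp add: vec_eq_iff_option)

lemma bordered_sum:
  assumes "finite I"
  shows "(\<Sum>i\<in>I. l i *\<^sub>R bordered (a i) (y i) (M i)) =
    bordered (\<Sum>i\<in>I. l i * a i) (\<Sum>i\<in>I. l i *\<^sub>R y i) (\<Sum>i\<in>I. l i *\<^sub>R M i)"
  using assms
  by induction (simp_all add: bordered_add bordered_scaleR, simp add: vec_eq_iff_option)

lemma transpose_bordered: "transpose (bordered a y M) = bordered a y (transpose M)"
  by (simp add: vec_eq_iff_option transpose_def)

lemma bordered_collapse: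
  assumes "transpose Y = Y"
  shows "bordered (Y $ None $ None) (\<chi> j. Y $ None $ Some j) (\<chi> i j. Y $ Some i $ Some j) = Y"
  using transpose_eq_nth[OF assms] by (simp add: vec_eq_iff_option)

lemma outer_option:
  "outer w = bordered ((w $ None)\<^sup>2) (w $ None *\<^sub>R (\<chi> i. w $ Some i)) (outer (\<chi> i. w $ Some i))"
  by (simp add: vec_eq_iff_option outer_def power2_eq_square)

lemma lifted_outer: "(x, outer x) \<in> lifted"
proof -
  have "outer (\<chi> r. case r of None \<Rightarrow> 1 | Some i \<Rightarrow> x $ i) = bordered 1 x (outer x)"
    by (simp add: vec_eq_iff_option outer_def)
  then show ?thesis by (metis (mono_tags) lifted_def mem_Collect_eq old.prod.case psd_outer)
qed

lemma outer_scaleR: "outer (r *\<^sub>R x) = r\<^sup>2 *\<^sub>R outer x"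
  by (simp add: outer_def vec_eq_iff power2_eq_square)

text \<open>Weak duality: the pairing of the two semidefinite bordered matrices is
  \<open>- t + c \<bullet> x + Q \<bullet> X\<close>, nonnegative by
  \<open>psd_inner_nonneg\<close>.\<close>

lemma psd_bordered_lifted:
  assumes "psd (bordered (- t) ((1 / 2) *\<^sub>R c) Q)" "(x, X) \<in> lifted"
  shows "t \<le> Q \<bullet> X + c \<bullet> x"
  using psd_inner_nonneg[OF assms(1), of "bordered 1 x X"] assms(2)
  by (simp add: lifted_def inner_bordered)

lemma quadratic_bounded_below:
  fixes m l t :: real
  assumes "\<And>k. t \<le> k\<^sup>2 * m + k * l"
  shows "0 \<le> m"
proof (rule ccontr)
  assume "\<not> 0 \<le> m"
  then have m: "m < 0" by simp
  \<comment> \<open>Chosen so that the quadratic term is \<open>- (\<bar>t\<bar> + 1)\<close>;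
    adding the bounds at \<open>k\<close> and \<open>-k\<close> cancels the linear term.\<close>
  define k where "k = sqrt ((\<bar>t\<bar> + 1) / (- m))"
  have "k\<^sup>2 = (\<bar>t\<bar> + 1) / (- m)" using m by (simp add: k_def divide_nonneg_neg)
  then have "k\<^sup>2 * m = - (\<bar>t\<bar> + 1)" using m by simp
  then show False using assms[of k] assms[of "-k"] by simp
qed

text \<open>Homogenise the lower bound: for a nonzero first coordinate \<open>a\<close>, scale the
  bound at \<open>y / a\<close> by the square of \<open>a\<close>; for \<open>a = 0\<close>,
  boundedness along the line through \<open>y\<close> makes its quadratic part nonnegative.\<close>

lemma psd_bordered_of_lower_bound:
  fixes Q :: "real ^ 'n ^ 'n"
  assumes sym: "transpose Q = Q" and lb: "\<And>x. t \<le> Q \<bullet> outer x + c \<bullet> x"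
  shows "psd (bordered (- t) ((1 / 2) *\<^sub>R c) Q)"
proof -
  have "0 \<le> bordered (- t) ((1 / 2) *\<^sub>R c) Q \<bullet> outer w" for w
  proof -
    define a where "a = w $ None"
    define y where "y = (\<chi> i. w $ Some i)"
    have val: "bordered (- t) ((1 / 2) *\<^sub>R c) Q \<bullet> outer w = - t * a\<^sup>2 + a * (c \<bullet> y) + Q \<bullet> outer y"
      by (subst outer_option) (simp add: inner_bordered a_def y_def)
    show ?thesis
    proof (cases "a = 0")
      case True
      have "t \<le> k\<^sup>2 * (Q \<bullet> outer y) + k * (c \<bullet> y)" for k
        using lb[of "k *\<^sub>R y"] by (simp add: outer_scaleR)
      then have "0 \<le> Q \<bullet> outer y" by (rule quadratic_bounded_below)
      then show ?thesis using val True by simp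
    next
      case False
      have "a\<^sup>2 * t \<le> a\<^sup>2 * (Q \<bullet> outer ((1 / a) *\<^sub>R y) + c \<bullet> ((1 / a) *\<^sub>R y))"
        by (intro mult_left_mono lb) simp
      also have "\<dots> = Q \<bullet> outer y + a * (c \<bullet> y)"
        using False by (simp add: outer_scaleR field_simps power2_eq_square)
      finally show ?thesis using val by (simp add: mult.commute)
    qed
  qed
  then show ?thesis using sym by (simp add: psd_iff transpose_bordered)
qed

section \<open>Lagrange multipliers over a compact convex set\<close>

text \<open>Project \<open>C\<close> to the plane of values of \<open>f\<close> and
  \<open>g\<close>, and separate the compact convex image strictly from the closed convex set of
  forbidden pairs.\<close>

lemma lagrange_step:
  fixes C :: "'a::euclidean_space set"
  assumes C: "compact C" "convex C"
    and pos: "\<And>Y. Y \<in> C \<Longrightarrow> (if ineq then g \<bullet> Y \<le> 0 else g \<bullet> Y = 0) \<Longrightarrow> 0 < f \<bullet> Y"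
  shows "\<exists>b. (ineq \<longrightarrow> 0 \<le> b) \<and> (\<forall>Y\<in>C. 0 < (f + b *\<^sub>R g) \<bullet> Y)"
proof (cases "C = {}")
  case True
  then show ?thesis by auto
next
  case ne: False
  define S where "S = (\<lambda>Y. (f \<bullet> Y, g \<bullet> Y)) ` C"
  \<comment> \<open>The forbidden pairs: the constraint on \<open>g\<close> holds although
    \<open>f\<close> is not positive.\<close>
  define T :: "(real \<times> real) set" where "T = {..0} \<times> (if ineq then {..0} else {0})"
  have lin: "linear (\<lambda>Y. (f \<bullet> Y, g \<bullet> Y))"
    by (auto intro!: linearI simp: inner_add_right)
  have "compact S"
    unfolding S_def by (intro compact_continuous_image C continuous_intros)
  moreover have "convex S"
    unfolding S_def by (intro convex_linear_image lin C)
  moreover have "S \<noteq> {}" using ne by (simp add: S_def)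
  moreover have "closed T" "convex T"
    by (auto simp: T_def intro!: closed_Times convex_Times)
  moreover have "T \<inter> S = {}"
  proof -
    have False if "Y \<in> C" "(f \<bullet> Y, g \<bullet> Y) \<in> T" for Y
      using pos[of Y] that by (auto simp: T_def split: if_splits)
    then show ?thesis by (auto simp: S_def)
  qed
  ultimately obtain a b where T: "\<And>x. x \<in> T \<Longrightarrow> a \<bullet> x < b" and S: "\<And>x. x \<in> S \<Longrightarrow> b < a \<bullet> x"
    using separating_hyperplane_closed_compact[of T S] by metis
  obtain a1 a2 where a: "a = (a1, a2)" by fastforce
  have b: "0 < b" using T[of "(0, 0)"] by (simp add: T_def a)
  \<comment> \<open>\<open>T\<close> contains negative half-axes, on which the separating functional
    stays below \<open>b\<close>; this fixes the signs of its coefficients.\<close>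
  have nonneg: "0 \<le> z" if "\<And>n. - real n * z < b" for z
  proof (rule ccontr)
    assume "\<not> 0 \<le> z"
    then obtain n where "b < real n * (- z)" using reals_Archimedean3[of "- z"] by auto
    then show False using that[of n] by simp
  qed
  have a1: "0 \<le> a1"
  proof (rule nonneg)
    show "- real n * a1 < b" for n
      using T[of "(- real n, 0)"] by (simp add: T_def a mult.commute)
  qed
  have a2: "0 \<le> a2" if ineq
  proof (rule nonneg)
    show "- real n * a2 < b" for n
      using T[of "(0, - real n)"] that by (simp add: T_def a mult.commute)
  qed
  have "bounded ((\<lambda>Y. f \<bullet> Y) ` C)"
    by (intro compact_imp_bounded compact_continuous_image C continuous_intros)
  then obtain m where m: "m > 0" "\<And>Y. Y \<in> C \<Longrightarrow> \<bar>f \<bullet> Y\<bar> \<le> m"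
    by (auto simp: bounded_pos)
  text \<open>The coefficient \<open>a1\<close> of \<open>f\<close> may vanish; compactness leaves room to make it positive.\<close>
  define r where "r = a1 + b / m"
  have r: "0 < r" using a1 b m by (simp add: r_def add_nonneg_pos)
  have "0 < (f + (a2 / r) *\<^sub>R g) \<bullet> Y" if Y: "Y \<in> C" for Y
  proof -
    have "b < a1 * (f \<bullet> Y) + a2 * (g \<bullet> Y)"
      using S[of "(f \<bullet> Y, g \<bullet> Y)"] Y by (simp add: S_def a)
    \<comment> \<open>The extra term \<open>(b / m) * (f \<bullet> Y)\<close> is at least
      \<open>- b\<close>, which the margin \<open>b\<close> of the separation absorbs.\<close>
    moreover have "(b / m) * (- (f \<bullet> Y)) \<le> (b / m) * m"
      using m(2)[OF Y] b m(1) by (intro mult_left_mono) auto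
    ultimately have "0 < r * (f \<bullet> Y) + a2 * (g \<bullet> Y)"
      using m(1) by (simp add: r_def algebra_simps)
    also have "\<dots> = r * ((f + (a2 / r) *\<^sub>R g) \<bullet> Y)"
      using r by (simp add: inner_add_left field_simps)
    finally show ?thesis using r by (simp add: zero_less_mult_iff)
  qed
  then show ?thesis using a2 r by (intro exI[of _ "a2 / r"]) auto
qed

lemma compact_convex_constraints:
  fixes C :: "'a::euclidean_space set" and G :: "'i \<Rightarrow> 'a" and I N :: "'i set"
  assumes "compact C" "convex C"
  defines "C' \<equiv> {Y \<in> C. \<forall>i\<in>I. if i \<in> N then G i \<bullet> Y \<le> 0 else G i \<bullet> Y = 0}"
  shows "compact C'" "convex C'"
proof -
  have eq: "C' = C \<inter> (\<Inter>i\<in>I. if i \<in> N then {Y. G i \<bullet> Y \<le> 0} else {Y. G i \<bullet> Y = 0})"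
    by (auto simp: C'_def split: if_splits)
  show "compact C'"
    unfolding eq using assms
    by (intro compact_Int_closed closed_INT) (auto simp: closed_halfspace_le closed_hyperplane)
  show "convex C'"
    unfolding eq using assms
    by (intro convex_Int convex_INT) (auto simp: convex_halfspace_le convex_hyperplane)
qed

text \<open>Constraints are traded for multipliers one at a time: the induction hypothesis is
  applied to the slice of \<open>C\<close> cut out by constraint \<open>k\<close>, and
  \<open>lagrange_step\<close> then releases that constraint. Hence \<open>C\<close> must be
  arbitrary.\<close>

lemma lagrange_multipliers:
  fixes C :: "'a::euclidean_space set"
  assumes "finite I" "compact C" "convex C"
    and "\<And>Y. Y \<in> C \<Longrightarrow> \<forall>i\<in>I. if i \<in> N then G i \<bullet> Y \<le> 0 else G i \<bullet> Y = 0 \<Longrightarrow> 0 < f \<bullet> Y"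
  shows "\<exists>l. (\<forall>i\<in>I. i \<in> N \<longrightarrow> 0 \<le> l i) \<and> (\<forall>Y\<in>C. 0 < (f + (\<Sum>i\<in>I. l i *\<^sub>R G i)) \<bullet> Y)"
  using assms
proof (induction arbitrary: C)
  case empty
  then show ?case by simp
next
  case (insert k I)
  define C' where "C' = {Y \<in> C. \<forall>i\<in>{k}. if i \<in> N then G i \<bullet> Y \<le> 0 else G i \<bullet> Y = 0}"
  have "compact C'" "convex C'"
    unfolding C'_def using insert.prems by (intro compact_convex_constraints; simp)+
  moreover have "0 < f \<bullet> Y"
    if "Y \<in> C'" "\<forall>i\<in>I. if i \<in> N then G i \<bullet> Y \<le> 0 else G i \<bullet> Y = 0" for Y
    using that insert.prems(3)[of Y] by (simp add: C'_def)
  ultimately obtain l where l: "\<forall>i\<in>I. i \<in> N \<longrightarrow> 0 \<le> l i"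
    and pos: "\<forall>Y\<in>C'. 0 < (f + (\<Sum>i\<in>I. l i *\<^sub>R G i)) \<bullet> Y"
    using insert.IH[of C'] by blast
  have "\<exists>b. (k \<in> N \<longrightarrow> 0 \<le> b) \<and> (\<forall>Y\<in>C. 0 < ((f + (\<Sum>i\<in>I. l i *\<^sub>R G i)) + b *\<^sub>R G k) \<bullet> Y)"
    using insert.prems pos by (intro lagrange_step) (auto simp: C'_def)
  then obtain b where b: "k \<in> N \<longrightarrow> 0 \<le> b"
    "\<forall>Y\<in>C. 0 < ((f + (\<Sum>i\<in>I. l i *\<^sub>R G i)) + b *\<^sub>R G k) \<bullet> Y"
    by blast
  have "(\<Sum>i\<in>insert k I. (l(k := b)) i *\<^sub>R G i) = b *\<^sub>R G k + (\<Sum>i\<in>I. l i *\<^sub>R G i)"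
    using insert.hyps by (auto intro!: sum.cong)
  then show ?case using b l insert.hyps
    by (intro exI[of _ "l(k := b)"]) (auto simp: add_ac)
qed

section \<open>Duality for the relaxation\<close>

lemma transpose_Q_mult:
  assumes "quadratic_program P"
  shows "transpose (Q_mult P \<mu> \<nu>) = Q_mult P \<mu> \<nu>"
proof -
  have "obj_Q P $ i $ j = obj_Q P $ j $ i"
    "k \<in> {1..con_num P} \<Longrightarrow> con_B P k $ i $ j = con_B P k $ j $ i"
    "k \<in> {1..red_num P} \<Longrightarrow> red_B P k $ i $ j = red_B P k $ j $ i" for i j k
    using assms unfolding quadratic_program_def by (blast intro: transpose_eq_nth)+
  then show ?thesis
    by (auto simp: vec_eq_iff transpose_def Q_mult_def intro!: arg_cong2[where f="(+)"] sum.cong)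
qed

lemma At_mult_feasible: "x \<in> lin_feasible P \<Longrightarrow> At_mult P \<beta> \<bullet> x = b_mult P \<beta>"
  by (simp add: lin_feasible_def At_mult_def b_mult_def inner_sum_left)

text \<open>Groups the Lagrangian as objective plus weighted residuals, whose signs can be read off
  at feasible points.\<close>

lemma lagrangian_expand:
  "Q_mult P \<mu> \<nu> \<bullet> X + c_mult P \<mu> \<nu> \<bullet> x - kappa P \<mu> \<nu> =
    obj_Q P \<bullet> X + obj_c P \<bullet> x
    + (\<Sum>i=1..con_num P. \<mu> i * (con_B P i \<bullet> X + con_d P i \<bullet> x - con_e P i))
    + (\<Sum>j=1..red_num P. \<nu> j * (red_B P j \<bullet> X + red_d P j \<bullet> x - red_e P j))"
  by (simp add: Q_mult_def c_mult_def kappa_def inner_add_left inner_sum_left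
      right_diff_distrib distrib_left sum.distrib sum_subtractf)

section \<open>Inequalities valid for every quadratic program\<close>

lemma dual_le_total_X: "sdp_dual_value P \<le> total_lagrangian_X P" for P :: "'n::finite qp"
  unfolding sdp_dual_value_def total_lagrangian_X_def
proof (rule SUP_least, clarify)
  fix t \<mu> \<nu> \<beta>
  assume feas: "(t, \<mu>, \<nu>, \<beta>) \<in> dual_feasible P"
  have "ereal (t - kappa P \<mu> \<nu> - b_mult P \<beta>) \<le> (INF (x, X)\<in>lifted.
      ereal (Q_mult P \<mu> \<nu> \<bullet> X + (c_mult P \<mu> \<nu> + At_mult P \<beta>) \<bullet> x - kappa P \<mu> \<nu> - b_mult P \<beta>))"
  proof (rule INF_greatest, clarify)
    fix x :: "real ^ 'n" and X :: "real ^ 'n ^ 'n"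
    assume "(x, X) \<in> lifted"
    then have "t \<le> Q_mult P \<mu> \<nu> \<bullet> X + (c_mult P \<mu> \<nu> + At_mult P \<beta>) \<bullet> x"
      using feas by (intro psd_bordered_lifted) (auto simp: dual_feasible_def)
    then show "ereal (t - kappa P \<mu> \<nu> - b_mult P \<beta>) \<le> ereal (Q_mult P \<mu> \<nu> \<bullet> X
        + (c_mult P \<mu> \<nu> + At_mult P \<beta>) \<bullet> x - kappa P \<mu> \<nu> - b_mult P \<beta>)"
      by simp
  qed
  moreover have "(\<mu>, \<nu>, \<beta>) \<in> multipliers P \<times> UNIV \<times> UNIV"
    using feas by (simp add: dual_feasible_def)
  ultimately show "ereal (t - kappa P \<mu> \<nu> - b_mult P \<beta>) \<le>
      (SUP (\<mu>, \<nu>, \<beta>)\<in>multipliers P \<times> UNIV \<times> UNIV. INF (x, X)\<in>lifted.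
        ereal (Q_mult P \<mu> \<nu> \<bullet> X + (c_mult P \<mu> \<nu> + At_mult P \<beta>) \<bullet> x - kappa P \<mu> \<nu> - b_mult P \<beta>))"
    by (intro SUP_upper2[where i="(\<mu>, \<nu>, \<beta>)"]) auto
qed

text \<open>Each \<open>x\<close> lifts to \<open>(x, outer x)\<close>, so for fixed multipliers the
  lifted infimum ranges over at least as many values.\<close>

lemma total_X_le_total_x: "total_lagrangian_X P \<le> total_lagrangian_x P" for P :: "'n::finite qp"
  unfolding total_lagrangian_X_def total_lagrangian_x_def
proof (intro SUP_mono', clarify)
  fix \<mu> \<nu> \<beta>
  show "(INF (x, X)\<in>lifted. ereal (Q_mult P \<mu> \<nu> \<bullet> X + (c_mult P \<mu> \<nu> + At_mult P \<beta>) \<bullet> x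
        - kappa P \<mu> \<nu> - b_mult P \<beta>))
    \<le> (INF x. ereal (Q_mult P \<mu> \<nu> \<bullet> outer x + (c_mult P \<mu> \<nu> + At_mult P \<beta>) \<bullet> x
        - kappa P \<mu> \<nu> - b_mult P \<beta>))"
  proof (rule INF_greatest)
    fix x :: "real ^ 'n"
    show "(INF (x, X)\<in>lifted. ereal (Q_mult P \<mu> \<nu> \<bullet> X + (c_mult P \<mu> \<nu> + At_mult P \<beta>) \<bullet> x
          - kappa P \<mu> \<nu> - b_mult P \<beta>))
      \<le> ereal (Q_mult P \<mu> \<nu> \<bullet> outer x + (c_mult P \<mu> \<nu> + At_mult P \<beta>) \<bullet> x
          - kappa P \<mu> \<nu> - b_mult P \<beta>)"
      by (rule INF_lower2[OF lifted_outer[of x]]) simp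
  qed
qed

lemma total_x_le_dual:
  assumes "quadratic_program P"
  shows "total_lagrangian_x P \<le> sdp_dual_value P"
  unfolding total_lagrangian_x_def
proof (rule SUP_least, clarify)
  fix \<mu> \<nu> \<beta>
  assume \<mu>: "\<mu> \<in> multipliers P"
  let ?f = "\<lambda>x. Q_mult P \<mu> \<nu> \<bullet> outer x + (c_mult P \<mu> \<nu> + At_mult P \<beta>) \<bullet> x - kappa P \<mu> \<nu> - b_mult P \<beta>"
  show "(INF x. ereal (?f x)) \<le> sdp_dual_value P"
  \<comment> \<open>Real numbers strictly below the infimum suffice, so it need not be finite or
    attained; each becomes the value of a dual feasible point.\<close>
  proof (rule dense_le)
    fix z
    assume z: "z < (INF x. ereal (?f x))"
    show "z \<le> sdp_dual_value P"
    proof (cases z)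
      case (real r)
      have lb: "r + kappa P \<mu> \<nu> + b_mult P \<beta> \<le> Q_mult P \<mu> \<nu> \<bullet> outer x + (c_mult P \<mu> \<nu> + At_mult P \<beta>) \<bullet> x" for x
      proof -
        have "z < ereal (?f x)" using z by (rule less_INF_D) simp
        then show ?thesis using real by simp
      qed
      have "(r + kappa P \<mu> \<nu> + b_mult P \<beta>, \<mu>, \<nu>, \<beta>) \<in> dual_feasible P"
        using \<mu> psd_bordered_of_lower_bound[OF transpose_Q_mult[OF assms] lb]
        by (simp add: dual_feasible_def)
      then show ?thesis
        unfolding sdp_dual_value_def by (rule SUP_upper2) (simp add: real)
    next
      case PInf
      then show ?thesis using z by simp
    qed simp
  qed
qed

text \<open>On \<open>lin_feasible P\<close> the terms with \<beta> cancel, and restricting an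
  infimum to those points can only raise it.\<close>

lemma total_X_le_partial_X: "total_lagrangian_X P \<le> partial_lagrangian_X P"
  unfolding total_lagrangian_X_def
proof (rule SUP_least, clarify)
  fix \<mu> \<nu> \<beta>
  assume \<mu>: "\<mu> \<in> multipliers P"
  have "(INF (x, X)\<in>lifted. ereal (Q_mult P \<mu> \<nu> \<bullet> X + (c_mult P \<mu> \<nu> + At_mult P \<beta>) \<bullet> x
        - kappa P \<mu> \<nu> - b_mult P \<beta>))
    \<le> (INF (x, X)\<in>{(x, X)\<in>lifted. x \<in> lin_feasible P}.
        ereal (Q_mult P \<mu> \<nu> \<bullet> X + c_mult P \<mu> \<nu> \<bullet> x - kappa P \<mu> \<nu>))"
    by (rule INF_mono) (force simp: inner_add_left At_mult_feasible)
  also have "\<dots> \<le> partial_lagrangian_X P"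
    unfolding partial_lagrangian_X_def using \<mu> by (intro SUP_upper2[where i="(\<mu>, \<nu>)"]) auto
  finally show "(INF (x, X)\<in>lifted. ereal (Q_mult P \<mu> \<nu> \<bullet> X + (c_mult P \<mu> \<nu> + At_mult P \<beta>) \<bullet> x
        - kappa P \<mu> \<nu> - b_mult P \<beta>)) \<le> partial_lagrangian_X P" .
qed

lemma partial_X_le_sdp: "partial_lagrangian_X P \<le> sdp_value P"
  unfolding partial_lagrangian_X_def sdp_value_def
proof (rule SUP_least, rule INF_greatest, clarify)
  fix \<mu> \<nu> x X
  assume \<mu>: "\<mu> \<in> multipliers P" and feas: "(x, X) \<in> sdp_feasible P"
  have "(\<Sum>i=1..con_num P. \<mu> i * (con_B P i \<bullet> X + con_d P i \<bullet> x - con_e P i)) \<le> 0"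
  proof (rule sum_nonpos)
    fix i assume i: "i \<in> {1..con_num P}"
    then have "if i \<in> ineqs P then con_B P i \<bullet> X + con_d P i \<bullet> x \<le> con_e P i
      else con_B P i \<bullet> X + con_d P i \<bullet> x = con_e P i"
      using feas by (simp add: sdp_feasible_def)
    then show "\<mu> i * (con_B P i \<bullet> X + con_d P i \<bullet> x - con_e P i) \<le> 0"
      using \<mu> i by (auto simp: multipliers_def mult_nonneg_nonpos split: if_splits)
  qed
  moreover have "(\<Sum>j=1..red_num P. \<nu> j * (red_B P j \<bullet> X + red_d P j \<bullet> x - red_e P j)) = 0"
    using feas by (intro sum.neutral) (auto simp: sdp_feasible_def)
  ultimately have "Q_mult P \<mu> \<nu> \<bullet> X + c_mult P \<mu> \<nu> \<bullet> x - kappa P \<mu> \<nu> \<le> obj_Q P \<bullet> X + obj_c P \<bullet> x"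
    unfolding lagrangian_expand by linarith
  moreover have "(x, X) \<in> {(x, X)\<in>lifted. x \<in> lin_feasible P}"
    using feas by (simp add: sdp_feasible_def)
  ultimately show "(INF (x, X)\<in>{(x, X)\<in>lifted. x \<in> lin_feasible P}.
      ereal (Q_mult P \<mu> \<nu> \<bullet> X + c_mult P \<mu> \<nu> \<bullet> x - kappa P \<mu> \<nu>)) \<le> ereal (obj_Q P \<bullet> X + obj_c P \<bullet> x)"
    by (intro INF_lower2[where i="(x, X)"]) auto
qed

text \<open>Redundancy makes the residuals weighted by \<nu> vanish at \<open>outer x\<close> for
  linearly feasible \<open>x\<close>, so \<nu> drops out together with \<beta>.\<close>

lemma total_x_le_partial_x:
  assumes "quadratic_program P"
  shows "total_lagrangian_x P \<le> partial_lagrangian_x P"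
  unfolding total_lagrangian_x_def
proof (rule SUP_least, clarify)
  fix \<mu> \<nu> \<beta>
  assume \<mu>: "\<mu> \<in> multipliers P"
  have eq: "Q_mult P \<mu> \<nu> \<bullet> outer x + (c_mult P \<mu> \<nu> + At_mult P \<beta>) \<bullet> x - kappa P \<mu> \<nu> - b_mult P \<beta>
      = Q_mult P \<mu> (\<lambda>_. 0) \<bullet> outer x + c_mult P \<mu> (\<lambda>_. 0) \<bullet> x - (\<Sum>i=1..con_num P. \<mu> i * con_e P i)"
    if x: "x \<in> lin_feasible P" for x
  proof -
    have "(\<Sum>j=1..red_num P. \<nu> j * (red_B P j \<bullet> outer x + red_d P j \<bullet> x - red_e P j)) = 0"
      using assms x by (intro sum.neutral) (auto simp: quadratic_program_def)
    then show ?thesis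
      using lagrangian_expand[of P \<mu> \<nu> "outer x" x] lagrangian_expand[of P \<mu> "\<lambda>_. 0" "outer x" x]
      by (simp add: inner_add_left At_mult_feasible[OF x] kappa_def)
  qed
  have "(INF x. ereal (Q_mult P \<mu> \<nu> \<bullet> outer x + (c_mult P \<mu> \<nu> + At_mult P \<beta>) \<bullet> x
        - kappa P \<mu> \<nu> - b_mult P \<beta>))
    \<le> (INF x\<in>lin_feasible P. ereal (Q_mult P \<mu> (\<lambda>_. 0) \<bullet> outer x + c_mult P \<mu> (\<lambda>_. 0) \<bullet> x
        - (\<Sum>i=1..con_num P. \<mu> i * con_e P i)))"
    by (intro INF_superset_mono subset_UNIV) (simp only: eq order_refl)
  also have "\<dots> \<le> partial_lagrangian_x P"
    unfolding partial_lagrangian_x_def using \<mu> by (rule SUP_upper)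
  finally show "(INF x. ereal (Q_mult P \<mu> \<nu> \<bullet> outer x + (c_mult P \<mu> \<nu> + At_mult P \<beta>) \<bullet> x
        - kappa P \<mu> \<nu> - b_mult P \<beta>)) \<le> partial_lagrangian_x P" .
qed

section \<open>Homogenisation and the inequality closing the cycle\<close>

definition con_hom :: "'n::finite qp \<Rightarrow> nat \<Rightarrow> real ^ ('n option) ^ ('n option)" where
  "con_hom P i = bordered (- con_e P i) ((1 / 2) *\<^sub>R con_d P i) (con_B P i)"

definition red_hom :: "'n::finite qp \<Rightarrow> nat \<Rightarrow> real ^ ('n option) ^ ('n option)" where
  "red_hom P j = bordered (- red_e P j) ((1 / 2) *\<^sub>R red_d P j) (red_B P j)"

definition lin_hom :: "'n::finite qp \<Rightarrow> nat \<Rightarrow> real ^ ('n option) ^ ('n option)" where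
  "lin_hom P k = bordered (- lin_b P k) ((1 / 2) *\<^sub>R lin_A P k) 0"

text \<open>Paired with \<open>bordered a x X\<close>, this is the objective minus
  \<open>a * s\<close>, so positivity at corner 1 means an objective value above
  \<open>s\<close>.\<close>

definition obj_hom :: "'n::finite qp \<Rightarrow> real \<Rightarrow> real ^ ('n option) ^ ('n option)" where
  "obj_hom P s = bordered (- s) ((1 / 2) *\<^sub>R obj_c P) (obj_Q P)"

text \<open>The aggregated matrix is the dual slack for
  \<open>t = s + kappa P \<mu> \<nu> + b_mult P \<beta>\<close>, whose dual objective value is
  exactly \<open>s\<close>.\<close>

lemma lagrangian_hom:
  "obj_hom P s + (\<Sum>k=1..lin_num P. \<beta> k *\<^sub>R lin_hom P k) + (\<Sum>j=1..red_num P. \<nu> j *\<^sub>R red_hom P j)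
     + (\<Sum>i=1..con_num P. \<mu> i *\<^sub>R con_hom P i)
   = bordered (- (s + kappa P \<mu> \<nu> + b_mult P \<beta>)) ((1 / 2) *\<^sub>R (c_mult P \<mu> \<nu> + At_mult P \<beta>)) (Q_mult P \<mu> \<nu>)"
proof -
  have half: "(\<Sum>i\<in>I. l i *\<^sub>R (1 / 2) *\<^sub>R y i) = (1 / 2) *\<^sub>R (\<Sum>i\<in>I. l i *\<^sub>R y i)"
    for l :: "nat \<Rightarrow> real" and y :: "nat \<Rightarrow> real ^ 'n" and I
    by (simp add: scaleR_sum_right mult.commute)
  show ?thesis
    unfolding obj_hom_def lin_hom_def red_hom_def con_hom_def bordered_sum[OF finite_atLeastAtMost]
      bordered_add half
    by (simp add: kappa_def b_mult_def c_mult_def At_mult_def Q_mult_def scaleR_add_right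
        sum_negf add_ac)
      (rule arg_cong[where f = "\<lambda>u. bordered u _ _"], simp)
qed

text \<open>
  For a 0-1 program the cone of solutions of the homogenised constraints contains no nonzero matrix
  with vanishing corner: the corner entry controls the first row, and the constraints
  \<open>X\<^sub>i\<^sub>i = x\<^sub>i\<close> then control the diagonal.
\<close>

lemma hom_infeasible:
  fixes P :: "'n::finite qp"
  assumes bij: "bij_betw \<sigma> {1..CARD('n)} UNIV" and zo: "zero_one_program \<sigma> P"
    and s: "ereal s < sdp_value P"
    and Y: "Y \<in> spectrahedron"
    and con: "\<forall>i\<in>{1..con_num P}. if i \<in> ineqs P then con_hom P i \<bullet> Y \<le> 0 else con_hom P i \<bullet> Y = 0"
    and red: "\<forall>j\<in>{1..red_num P}. red_hom P j \<bullet> Y = 0"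
    and lin: "\<forall>k\<in>{1..lin_num P}. lin_hom P k \<bullet> Y = 0"
  shows "0 < obj_hom P s \<bullet> Y"
proof -
  define a where "a = Y $ None $ None"
  define x where "x = (\<chi> j. Y $ None $ Some j)"
  define X where "X = (\<chi> i j. Y $ Some i $ Some j)"
  have psd: "psd Y" and tr: "(\<Sum>r\<in>UNIV. Y $ r $ r) = 1" using Y by (auto simp: spectrahedron_def)
  have Yeq: "Y = bordered a x X"
    using psd by (simp add: psd_iff a_def x_def X_def bordered_collapse)
  have con': "con_hom P i \<bullet> Y = con_B P i \<bullet> X + con_d P i \<bullet> x - a * con_e P i" for i
    by (simp add: con_hom_def Yeq inner_bordered)
  have red': "red_hom P i \<bullet> Y = red_B P i \<bullet> X + red_d P i \<bullet> x - a * red_e P i" for i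
    by (simp add: red_hom_def Yeq inner_bordered)
  have lin': "lin_hom P i \<bullet> Y = lin_A P i \<bullet> x - a * lin_b P i" for i
    by (simp add: lin_hom_def Yeq inner_bordered)
  have obj': "obj_hom P s \<bullet> Y = obj_Q P \<bullet> X + obj_c P \<bullet> x - a * s"
    by (simp add: obj_hom_def Yeq inner_bordered)
  have diag: "X $ k $ k = x $ k" for k
  proof -
    obtain i where i: "i \<in> {1..CARD('n)}" "\<sigma> i = k"
      using bij by (metis UNIV_I bij_betw_iff_bijections)
    \<comment> \<open>The coefficient matrix is a rank-one coordinate projector, so pairing with it
      reads off a diagonal entry.\<close>
    have B: "(\<chi> k l. if k = \<sigma> i \<and> l = \<sigma> i then 1 else 0) = outer (axis (\<sigma> i) (1::real))"
      by (auto simp: outer_def axis_def vec_eq_iff)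
    have "outer (axis k (1::real)) \<bullet> X = X $ k $ k"
      unfolding inner_commute[of _ X] inner_outer
      by (simp add: matrix_vector_mult_basis column_def inner_axis')
    moreover have "con_hom P i \<bullet> Y = 0"
      using con i zo by (auto simp: zero_one_program_def)
    ultimately show ?thesis
      using i zo B unfolding con' by (auto simp: zero_one_program_def inner_axis')
  qed
  have "a \<noteq> 0"
  proof
    assume a0: "a = 0"
    then have "x $ k = 0" for k
      using psd_diag_zero[OF psd, of None "Some k"] by (simp add: a_def x_def)
    then have "(\<Sum>r\<in>UNIV. Y $ r $ r) = 0"
      unfolding sum_option Yeq using a0 diag by simp
    then show False using tr by simp
  qed
  then have a: "0 < a" using psd_diag_nonneg[OF psd, of None] by (simp add: a_def)
  \<comment> \<open>Dividing by the positive corner undoes the homogenisation and yields a feasible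
    point of the relaxation.\<close>
  have "(1 / a) *\<^sub>R Y = bordered 1 ((1 / a) *\<^sub>R x) ((1 / a) *\<^sub>R X)"
    using a by (simp add: Yeq bordered_scaleR)
  then have "((1 / a) *\<^sub>R x, (1 / a) *\<^sub>R X) \<in> lifted"
    using psd_scaleR[OF psd, of "1 / a"] a by (simp add: lifted_def)
  moreover have "(1 / a) *\<^sub>R x \<in> lin_feasible P"
    using lin a unfolding lin' by (simp add: lin_feasible_def field_simps)
  moreover have "\<forall>j\<in>{1..red_num P}. red_B P j \<bullet> ((1 / a) *\<^sub>R X) + red_d P j \<bullet> ((1 / a) *\<^sub>R x) = red_e P j"
    using red a unfolding red' by (simp add: field_simps)
  moreover have "\<forall>i\<in>{1..con_num P}. if i \<in> ineqs P
      then con_B P i \<bullet> ((1 / a) *\<^sub>R X) + con_d P i \<bullet> ((1 / a) *\<^sub>R x) \<le> con_e P i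
      else con_B P i \<bullet> ((1 / a) *\<^sub>R X) + con_d P i \<bullet> ((1 / a) *\<^sub>R x) = con_e P i"
  proof
    fix i assume "i \<in> {1..con_num P}"
    then have "if i \<in> ineqs P then con_hom P i \<bullet> Y \<le> 0 else con_hom P i \<bullet> Y = 0"
      using con by blast
    then show "if i \<in> ineqs P
      then con_B P i \<bullet> ((1 / a) *\<^sub>R X) + con_d P i \<bullet> ((1 / a) *\<^sub>R x) \<le> con_e P i
      else con_B P i \<bullet> ((1 / a) *\<^sub>R X) + con_d P i \<bullet> ((1 / a) *\<^sub>R x) = con_e P i"
      using a unfolding con' by (simp add: field_simps split: if_splits)
  qed
  ultimately have "((1 / a) *\<^sub>R x, (1 / a) *\<^sub>R X) \<in> sdp_feasible P"
    unfolding sdp_feasible_def by blast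
  then have "sdp_value P \<le> ereal (obj_Q P \<bullet> ((1 / a) *\<^sub>R X) + obj_c P \<bullet> ((1 / a) *\<^sub>R x))"
    unfolding sdp_value_def by (rule INF_lower2) simp
  then have "ereal s < ereal (obj_Q P \<bullet> ((1 / a) *\<^sub>R X) + obj_c P \<bullet> ((1 / a) *\<^sub>R x))"
    using s by (rule order_less_le_trans[rotated])
  then show ?thesis using a unfolding obj' by (simp add: field_simps)
qed

text \<open>For nonzero \<open>v\<close>, \<open>outer v\<close> divided by its trace, the squared
  norm of \<open>v\<close>, lies in the slice.\<close>

lemma psd_of_spectrahedron_nonneg:
  assumes "transpose M = M" "\<And>Y. Y \<in> spectrahedron \<Longrightarrow> 0 \<le> M \<bullet> Y"
  shows "psd M"
proof -
  have "0 \<le> M \<bullet> outer v" for v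
  proof (cases "v = 0")
    case True
    then show ?thesis by (simp add: inner_outer)
  next
    case False
    have "(\<Sum>i\<in>UNIV. outer v $ i $ i) = (norm v)\<^sup>2"
      by (simp add: outer_def power2_norm_eq_inner inner_vec_def)
    then have "(1 / (norm v)\<^sup>2) *\<^sub>R outer v \<in> spectrahedron"
      using False psd_scaleR[OF psd_outer, of "1 / (norm v)\<^sup>2" v]
      by (simp add: spectrahedron_def flip: sum_divide_distrib)
    then have "0 \<le> (1 / (norm v)\<^sup>2) * (M \<bullet> outer v)" using assms(2) by fastforce
    then show ?thesis using False by (simp add: zero_le_divide_iff)
  qed
  then show ?thesis using assms(1) by (simp add: psd_iff)
qed

text \<open>The three constraint families are released in turn, over \<open>C2\<close>,
  \<open>C1\<close> and the whole spectrahedron. If the relaxation is infeasible, \<open>s\<close>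
  can be any real and the dual value is infinite.\<close>

lemma sdp_le_dual:
  fixes P :: "'n::finite qp"
  assumes qp: "quadratic_program P"
    and bij: "bij_betw \<sigma> {1..CARD('n)} UNIV" and zo: "zero_one_program \<sigma> P"
  shows "sdp_value P \<le> sdp_dual_value P"
proof (rule dense_le)
  fix z
  assume z: "z < sdp_value P"
  show "z \<le> sdp_dual_value P"
  proof (cases z)
    case (real s)
    define C1 where "C1 = {Y \<in> spectrahedron. \<forall>i\<in>{1..con_num P}.
      if i \<in> ineqs P then con_hom P i \<bullet> Y \<le> 0 else con_hom P i \<bullet> Y = 0}"
    \<comment> \<open>The empty set of inequality indices fits the general lemma and leaves the
      multipliers free in sign.\<close>
    define C2 where "C2 = {Y \<in> C1. \<forall>j\<in>{1..red_num P}.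
      if j \<in> {} then red_hom P j \<bullet> Y \<le> 0 else red_hom P j \<bullet> Y = 0}"
    have C1: "compact C1" "convex C1"
      unfolding C1_def
      by (intro compact_convex_constraints compact_spectrahedron convex_spectrahedron)+
    have C2: "compact C2" "convex C2"
      unfolding C2_def by (intro compact_convex_constraints C1)+
    have "\<exists>l. (\<forall>k\<in>{1..lin_num P}. k \<in> {} \<longrightarrow> 0 \<le> l k) \<and>
        (\<forall>Y\<in>C2. 0 < (obj_hom P s + (\<Sum>k=1..lin_num P. l k *\<^sub>R lin_hom P k)) \<bullet> Y)"
      using hom_infeasible[OF bij zo, of s] z real
      by (intro lagrange_multipliers C2) (auto simp: C1_def C2_def)
    then obtain \<beta> where \<beta>: "\<forall>Y\<in>C2. 0 < (obj_hom P s + (\<Sum>k=1..lin_num P. \<beta> k *\<^sub>R lin_hom P k)) \<bullet> Y"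
      by blast
    have "\<exists>l. (\<forall>j\<in>{1..red_num P}. j \<in> {} \<longrightarrow> 0 \<le> l j) \<and>
        (\<forall>Y\<in>C1. 0 < (obj_hom P s + (\<Sum>k=1..lin_num P. \<beta> k *\<^sub>R lin_hom P k)
          + (\<Sum>j=1..red_num P. l j *\<^sub>R red_hom P j)) \<bullet> Y)"
      using \<beta> by (intro lagrange_multipliers C1) (auto simp: C2_def)
    then obtain \<nu> where \<nu>: "\<forall>Y\<in>C1. 0 < (obj_hom P s + (\<Sum>k=1..lin_num P. \<beta> k *\<^sub>R lin_hom P k)
          + (\<Sum>j=1..red_num P. \<nu> j *\<^sub>R red_hom P j)) \<bullet> Y"
      by blast
    have "\<exists>l. (\<forall>i\<in>{1..con_num P}. i \<in> ineqs P \<longrightarrow> 0 \<le> l i) \<and>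
        (\<forall>Y\<in>spectrahedron. 0 < (obj_hom P s + (\<Sum>k=1..lin_num P. \<beta> k *\<^sub>R lin_hom P k)
          + (\<Sum>j=1..red_num P. \<nu> j *\<^sub>R red_hom P j) + (\<Sum>i=1..con_num P. l i *\<^sub>R con_hom P i)) \<bullet> Y)"
      using \<nu> by (intro lagrange_multipliers compact_spectrahedron convex_spectrahedron) (auto simp: C1_def)
    then obtain \<mu> where \<mu>: "\<mu> \<in> multipliers P"
      and pos: "\<And>Y. Y \<in> spectrahedron \<Longrightarrow> 0 < bordered (- (s + kappa P \<mu> \<nu> + b_mult P \<beta>))
        ((1 / 2) *\<^sub>R (c_mult P \<mu> \<nu> + At_mult P \<beta>)) (Q_mult P \<mu> \<nu>) \<bullet> Y"
      unfolding lagrangian_hom multipliers_def by blast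
    have "psd (bordered (- (s + kappa P \<mu> \<nu> + b_mult P \<beta>))
        ((1 / 2) *\<^sub>R (c_mult P \<mu> \<nu> + At_mult P \<beta>)) (Q_mult P \<mu> \<nu>))"
      using pos
      by (intro psd_of_spectrahedron_nonneg) (auto simp: transpose_bordered transpose_Q_mult[OF qp] less_imp_le)
    then have "(s + kappa P \<mu> \<nu> + b_mult P \<beta>, \<mu>, \<nu>, \<beta>) \<in> dual_feasible P"
      using \<mu> by (simp add: dual_feasible_def)
    then show ?thesis
      unfolding sdp_dual_value_def by (rule SUP_upper2) (simp add: real)
  next
    case PInf
    then show ?thesis using z by simp
  qed simp
qed

theorem theorem1:
  fixes P :: "'n::finite qp"
    and \<sigma> :: "nat \<Rightarrow> 'n"
  assumes "quadratic_program P"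
    and "bij_betw \<sigma> {1..CARD('n)} UNIV"
    and "zero_one_program \<sigma> P"
  shows "sdp_dual_value P = total_lagrangian_x P
       \<and> total_lagrangian_x P = total_lagrangian_X P
       \<and> total_lagrangian_X P = partial_lagrangian_X P
       \<and> partial_lagrangian_X P = sdp_value P
       \<and> sdp_value P \<le> partial_lagrangian_x P"
  using dual_le_total_X[of P] total_X_le_total_x[of P] total_x_le_dual[OF assms(1)]
    total_X_le_partial_X[of P] partial_X_le_sdp[of P] sdp_le_dual[OF assms]
    total_x_le_partial_x[OF assms(1)]
  by auto

end
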